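(* Let $k=2$. For each positive integer $m$, let $f:[m]^2\to[m]$ be chosen uniformly at random, let $(X_1,X_2)$ be uniform on $[m]^2$ and independent of $f$, let $X_{n+2}=f(X_n,X_{n+1})$ for $n\ge 1$, and let $W_n=(X_n,X_{n+1})$. Let $\tau$ be the least integer for which $W_{\tau-1}=W_j$ for some $1\le j<\tau-1$. Then, as $m\to\infty$, the quantity $\frac{\tau^2}{2m^2}$ converges in distribution to an exponential random variable of mean $1$. Furthermore, all moments of $\frac{\tau^2}{2m^2}$ converge to the corresponding moments of the exponential distribution of mean $1$. In particular, as $m\to\infty$, $$\mathbb{E}\,\tau \sim m\sqrt{\frac{\pi}{2}},\qquad \mathrm{Var}(\tau)\sim\left(2-\frac{\pi}{2}\right)m^2 .$$
   Context: $[m]:=\{1,\ldots,m\}$. The function $f$ is uniform among the $m^{m^2}$ functions $[m]^2\to[m]$. The notation $a_m\sim b_m$ means $a_m/b_m\to 1$ as $m\to\infty$. *)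

theory Defs
  imports "HOL-Probability.Probability" "HOL-Library.Landau_Symbols"
begin

(* An outcome is a pair (f, (x1, x2)): the map f on {1..m} x {1..m} together with the starting
   pair.  Maps are extensional, i.e. undefined outside {1..m} x {1..m}, so there are exactly
   m ^ (m ^ 2) of them.  Only m >= 1 is meaningful. *)
type_synonym outcome = "(nat \<times> nat \<Rightarrow> nat) \<times> (nat \<times> nat)"

definition model :: "nat \<Rightarrow> outcome pmf" where
  "model m = pair_pmf (pmf_of_set (({1..m} \<times> {1..m}) \<rightarrow>\<^sub>E {1..m}))
                      (pmf_of_set ({1..m} \<times> {1..m}))"

(* The sequence is indexed from 1, as in X_1, X_2, ...; the value at index 0 is a dummy that
   is never used. *)
fun X_seq :: "outcome \<Rightarrow> nat \<Rightarrow> nat" where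
  "X_seq \<omega> 0 = undefined"
| "X_seq \<omega> (Suc 0) = fst (snd \<omega>)"
| "X_seq \<omega> (Suc (Suc 0)) = snd (snd \<omega>)"
| "X_seq \<omega> (Suc (Suc (Suc n))) = fst \<omega> (X_seq \<omega> (Suc n), X_seq \<omega> (Suc (Suc n)))"

definition W_seq :: "outcome \<Rightarrow> nat \<Rightarrow> nat \<times> nat" where
  "W_seq \<omega> n = (X_seq \<omega> n, X_seq \<omega> (n + 1))"

(* The least element exists for every outcome in the support of model m with m >= 1, because
   W_seq takes at most m ^ 2 values.  Truncated subtraction is harmless: 1 <= j < t - 1
   forces t >= 3. *)
definition tau :: "outcome \<Rightarrow> nat" where
  "tau \<omega> = (LEAST t. \<exists>j. 1 \<le> j \<and> j < t - 1 \<and> W_seq \<omega> (t - 1) = W_seq \<omega> j)"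

definition scaled_tau :: "nat \<Rightarrow> outcome \<Rightarrow> real" where
  "scaled_tau m \<omega> = (real (tau \<omega>))\<^sup>2 / (2 * (real m)\<^sup>2)"

(* The exponential distribution of rate 1, i.e. of mean 1. *)
definition Exp1 :: "real measure" where
  "Exp1 = density lborel (\<lambda>x. ennreal (exponential_density 1 x))"

unbundle asymp_equiv_syntax

end

theory Submission
  imports Defs
begin

text \<open>
  As long as no pair has been repeated, every value of \<open>f\<close> that is read is fresh, so the word
  \<open>X\<^sub>1 \<dots> X\<^sub>n\<close> takes each of its possible repetition-free values with the same probability
  \<open>1 / m ^ n\<close>. Hence \<open>P(\<tau> > n) = N\<^sub>n / m ^ n\<close>, where \<open>N\<^sub>n\<close> counts the words of length \<open>n\<close>
  over an alphabet of \<open>m\<close> letters in which no pair of consecutive letters occurs twice, that is, the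
  trails in the complete digraph with loops (\<open>prob_tau_gt\<close>).

  Such words are grown by one letter on the left. In front of a word \<open>y w\<close> exactly those letters are
  forbidden that already precede an occurrence of \<open>y\<close> in it, and they are as many as the occurrences of
  \<open>y\<close> in \<open>w\<close>. On average this is about \<open>n / m\<close> letters, but the actual number fluctuates on the same
  scale. One step does not average it out, two steps do: if \<open>y\<close> is itself a freshly added letter, it
  ranges over the whole alphabet up to a few exceptions, and the occurrences of all letters in \<open>w\<close> sum
  to the length of \<open>w\<close>. This gives (\<open>card_trails_Suc_Suc\<close>)
  \<open>N\<^sub>n\<^sub>+\<^sub>2 = m N\<^sub>n\<^sub>+\<^sub>1 - n N\<^sub>n + E\<^sub>n\<close>, where \<open>E\<^sub>n \<ge> 0\<close> comes from the exceptions and is small because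
  words with many coincidences are rare (\<open>sum_trails_used_preds_le\<close>). For \<open>p\<^sub>n = N\<^sub>n / m ^ n\<close> and
  \<open>n = O(m)\<close> it follows that \<open>p\<^sub>n\<^sub>+\<^sub>1 = p\<^sub>n (1 - n / m\<^sup>2) + O(1 / m\<^sup>2)\<close>. The function
  \<open>exp (- n\<^sup>2 / (2 m\<^sup>2))\<close> satisfies the same relation, and the errors of \<open>O(m)\<close> steps add up to
  \<open>O(1 / m)\<close> (\<open>trail_freq_approx\<close>). This is convergence in distribution.

  For the moments, cutting a word in two shows \<open>p\<^sub>a\<^sub>+\<^sub>b \<le> p\<^sub>a p\<^sub>b\<close>. Since \<open>p\<^sub>2\<^sub>m\<close> tends to
  \<open>exp (- 2)\<close>, the tail of \<open>\<tau> / m\<close> decays exponentially, uniformly in \<open>m\<close>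
  (\<open>trail_freq_exp_tail\<close>). Writing a moment as an integral of the tail, dominated convergence gives the
  limit of every moment of \<open>\<tau> / (m \<surd>2)\<close> as a half-line Gaussian moment
  (\<open>rescaled_tau_moment_tendsto\<close>). The even moments are those of \<open>\<tau>\<^sup>2 / (2 m\<^sup>2)\<close>; the first moment
  gives the expectation of \<open>\<tau>\<close>, and the first two give the variance.
\<close>

section \<open>Counting words without repeated pairs\<close>

definition trails :: "'a set \<Rightarrow> nat \<Rightarrow> 'a list set" where
  "trails A n = {xs. length xs = n \<and> set xs \<subseteq> A \<and> distinct (zip xs (tl xs))}"

text \<open>
  The letters that cannot be put in front of a trail: each of them would repeat the pair that it
  already forms with an occurrence of the head further on.
\<close>
definition used_preds :: "'a list \<Rightarrow> 'a set" where
  "used_preds xs = {x. (x, hd xs) \<in> set (zip xs (tl xs))}"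

lemma finite_trails [simp]: "finite A \<Longrightarrow> finite (trails A n)"
  by (rule finite_subset[OF _ finite_lists_length_eq[of A n]]) (auto simp: trails_def)

lemma trails_0 [simp]: "trails A 0 = {[]}"
  by (auto simp: trails_def)

lemma trails_1: "trails A (Suc 0) = (\<lambda>x. [x]) ` A"
  by (auto simp: trails_def length_Suc_conv image_iff)

lemma used_preds_subset: "used_preds xs \<subseteq> set xs"
  by (auto simp: used_preds_def dest: set_zip_leftD)

lemma distinct_zip_Cons:
  assumes "xs \<noteq> []"
  shows "distinct (zip (x # xs) xs) \<longleftrightarrow> x \<notin> used_preds xs \<and> distinct (zip xs (tl xs))"
  using assms by (cases xs) (auto simp: used_preds_def)

lemma sum_trails_Suc:
  fixes g :: "'a list \<Rightarrow> 'b::comm_monoid_add"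
  assumes "finite A" and "n > 0"
  shows "(\<Sum>xs\<in>trails A (Suc n). g xs) = (\<Sum>ys\<in>trails A n. \<Sum>x\<in>A - used_preds ys. g (x # ys))"
proof -
  have "trails A (Suc n) = (\<lambda>(ys, x). x # ys) ` (SIGMA ys : trails A n. A - used_preds ys)"
  proof (intro equalityI subsetI)
    fix xs assume "xs \<in> trails A (Suc n)"
    then obtain x ys where xs: "xs = x # ys" "length ys = n" "x \<in> A" "set ys \<subseteq> A"
      "distinct (zip (x # ys) ys)"
      by (cases xs) (auto simp: trails_def)
    with \<open>n > 0\<close> have "ys \<noteq> []" by auto
    with xs have "(ys, x) \<in> (SIGMA ys : trails A n. A - used_preds ys)"
      by (auto simp: trails_def distinct_zip_Cons simp del: zip_Cons_Cons)
    then show "xs \<in> (\<lambda>(ys, x). x # ys) ` (SIGMA ys : trails A n. A - used_preds ys)"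
      using xs(1) by (auto simp: image_iff)
  next
    fix xs assume "xs \<in> (\<lambda>(ys, x). x # ys) ` (SIGMA ys : trails A n. A - used_preds ys)"
    then obtain x ys where xs: "xs = x # ys" "ys \<in> trails A n" "x \<in> A - used_preds ys" by auto
    with \<open>n > 0\<close> have "ys \<noteq> []" by (auto simp: trails_def)
    then show "xs \<in> trails A (Suc n)"
      using xs distinct_zip_Cons[of ys x] by (auto simp: trails_def)
  qed
  moreover have "inj_on (\<lambda>(ys, x). x # ys) (SIGMA ys : trails A n. A - used_preds ys)"
    by (auto simp: inj_on_def)
  ultimately show ?thesis
    using assms by (simp add: sum.reindex sum.Sigma case_prod_unfold)
qed

text \<open>
  Every occurrence of \<open>h\<close> in the second list contributes one pair, and distinctness of the pairs makes
  the first components of these pairs different.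
\<close>
lemma card_zip_fibre:
  assumes "distinct (zip xs ys)" and "length ys \<le> length xs"
  shows "card {x. (x, h) \<in> set (zip xs ys)} = count_list ys h"
  using assms
proof (induction ys arbitrary: xs)
  case Nil
  then show ?case by simp
next
  case (Cons y ys)
  then obtain x xs' where xs: "xs = x # xs'" by (cases xs) auto
  have fin: "finite {u. (u, h) \<in> set (zip xs' ys)}"
    by (rule finite_subset[of _ "set xs'"]) (auto dest: set_zip_leftD)
  have "{u. (u, h) \<in> set (zip xs (y # ys))} =
      (if y = h then insert x {u. (u, h) \<in> set (zip xs' ys)} else {u. (u, h) \<in> set (zip xs' ys)})"
    by (auto simp: xs)
  moreover have "y = h \<Longrightarrow> x \<notin> {u. (u, h) \<in> set (zip xs' ys)}"
    using Cons.prems by (auto simp: xs)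
  moreover have "card {u. (u, h) \<in> set (zip xs' ys)} = count_list ys h"
    using Cons by (auto simp: xs)
  ultimately show ?case using fin by auto
qed

lemma card_used_preds:
  assumes "xs \<in> trails A n"
  shows "card (used_preds xs) = count_list (tl xs) (hd xs)"
  unfolding used_preds_def using assms by (intro card_zip_fibre) (auto simp: trails_def)

lemma card_trails_Suc:
  assumes "finite A" and "n > 0"
  shows "int (card (trails A (Suc n))) =
    int (card A) * int (card (trails A n)) - int (\<Sum>xs\<in>trails A n. count_list (tl xs) (hd xs))"
proof -
  have "int (card (trails A (Suc n))) = (\<Sum>xs\<in>trails A n. int (card (A - used_preds xs)))"
    using sum_trails_Suc[OF assms, of "\<lambda>_. 1::nat"] by (simp flip: of_nat_sum)
  also have "\<dots> = (\<Sum>xs\<in>trails A n. int (card A) - int (count_list (tl xs) (hd xs)))"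
  proof (rule sum.cong[OF refl])
    fix xs assume xs: "xs \<in> trails A n"
    then have sub: "used_preds xs \<subseteq> A"
      using used_preds_subset[of xs] by (auto simp: trails_def)
    then have "card (used_preds xs) \<le> card A" using assms(1) card_mono by blast
    with sub show "int (card (A - used_preds xs)) =
        int (card A) - int (count_list (tl xs) (hd xs))"
      using assms(1) card_used_preds[OF xs] by (simp add: card_Diff_subset finite_subset of_nat_diff)
  qed
  finally show ?thesis by (simp add: sum_subtractf mult.commute)
qed

text \<open>
  The number of letters forbidden in the last step, which is the number of occurrences of the head in
  the tail, is summed over the head as the letter added in the step before. Over the whole alphabet this
  gives the length \<open>n\<close>; the letters forbidden as heads were counted in excess and form the last term.
\<close>
lemma card_trails_Suc_Suc:
  assumes "finite A" and "n > 0"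
  shows "int (card (trails A (Suc (Suc n)))) =
    int (card A) * int (card (trails A (Suc n))) - int n * int (card (trails A n)) +
    int (\<Sum>xs\<in>trails A n. \<Sum>x\<in>used_preds xs. count_list xs x)"
proof -
  have "int (\<Sum>xs\<in>trails A (Suc n). count_list (tl xs) (hd xs)) =
      (\<Sum>xs\<in>trails A n. int (\<Sum>x\<in>A - used_preds xs. count_list xs x))"
    using sum_trails_Suc[OF assms, of "\<lambda>xs. count_list (tl xs) (hd xs)"] by simp
  also have "\<dots> = (\<Sum>xs\<in>trails A n. int n - int (\<Sum>x\<in>used_preds xs. count_list xs x))"
  proof (rule sum.cong[OF refl])
    fix xs assume xs: "xs \<in> trails A n"
    then have sub: "used_preds xs \<subseteq> A" and "set xs \<subseteq> A" "length xs = n"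
      using used_preds_subset[of xs] by (auto simp: trails_def)
    then have "(\<Sum>x\<in>A. count_list xs x) = n"
      using sum_count_set assms(1) by fastforce
    moreover have "(\<Sum>x\<in>A. count_list xs x) =
        (\<Sum>x\<in>A - used_preds xs. count_list xs x) + (\<Sum>x\<in>used_preds xs. count_list xs x)"
      using sum.subset_diff[OF sub assms(1)] by simp
    ultimately show "int (\<Sum>x\<in>A - used_preds xs. count_list xs x) =
        int n - int (\<Sum>x\<in>used_preds xs. count_list xs x)" by linarith
  qed
  finally show ?thesis
    using card_trails_Suc[OF assms(1), of "Suc n"] by (simp add: sum_subtractf mult.commute)
qed

lemma sum_set_le_sum_list:
  fixes f :: "'a \<Rightarrow> nat"
  shows "sum f (set xs) \<le> sum_list (map f xs)"
  by (induction xs) (auto simp: sum.insert_if)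

text \<open>
  The first letter \<open>y\<close> is averaged over the alphabet, since for a fixed \<open>y\<close> the sum need not be small.
  A letter forbidden before \<open>y ws\<close> either precedes an occurrence of \<open>y\<close> inside \<open>ws\<close>, and then summing
  over \<open>y\<close> lets it run through the positions of \<open>ws\<close>, or it is \<open>y\<close> itself and \<open>ws\<close> starts with
  \<open>y\<close>. The sum on the right counts the ordered pairs of positions of \<open>ws\<close> with equal letters, each
  position being also paired with itself.
\<close>
lemma sum_used_preds_le:
  assumes "finite A" and "set ws \<subseteq> A"
  shows "(\<Sum>y\<in>A. \<Sum>x\<in>used_preds (y # ws). count_list (y # ws) x) \<le>
    sum_list (map (count_list ws) ws) + (2 * length ws + 1)"
proof (cases ws)
  case Nil
  then show ?thesis by (simp add: used_preds_def)
next
  case (Cons w vs)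
  define P where "P = set (zip ws (tl ws))"
  define c where "c = count_list ws"
  have finP: "finite P" by (simp add: P_def)
  have finX: "finite {x. (x, y) \<in> P}" for y
    by (rule finite_subset[OF _ finite_imageI[OF finP, of fst]]) force
  \<comment> \<open>The extra 1 accounts for the occurrence of the new letter \<open>y\<close> at the front.\<close>
  have "(\<Sum>x\<in>used_preds (y # ws). count_list (y # ws) x) \<le>
      (\<Sum>x | (x, y) \<in> P. c x + 1) + (if y = w then c w + 1 else 0)" for y
  proof -
    have "used_preds (y # ws) \<subseteq> {x. (x, y) \<in> P} \<union> (if y = w then {w} else {})"
      by (auto simp: used_preds_def P_def Cons)
    then have "(\<Sum>x\<in>used_preds (y # ws). count_list (y # ws) x) \<le>
        (\<Sum>x\<in>{x. (x, y) \<in> P} \<union> (if y = w then {w} else {}). count_list (y # ws) x)"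
      using finX by (intro sum_mono2) auto
    also have "\<dots> \<le> (\<Sum>x | (x, y) \<in> P. count_list (y # ws) x) +
        (\<Sum>x\<in>(if y = w then {w} else {}). count_list (y # ws) x)"
    proof -
      have "finite (if y = w then {w} else {})" by simp
      from sum.union_inter[OF finX[of y] this, of "count_list (y # ws)"]
      show ?thesis by linarith
    qed
    also have "\<dots> \<le> (\<Sum>x | (x, y) \<in> P. c x + 1) + (if y = w then c w + 1 else 0)"
      by (intro add_mono sum_mono) (auto simp: c_def)
    finally show ?thesis .
  qed
  then have "(\<Sum>y\<in>A. \<Sum>x\<in>used_preds (y # ws). count_list (y # ws) x) \<le>
      (\<Sum>y\<in>A. (\<Sum>x | (x, y) \<in> P. c x + 1) + (if y = w then c w + 1 else 0))"
    by (rule sum_mono)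
  also have "\<dots> = (\<Sum>y\<in>A. \<Sum>x | (x, y) \<in> P. c x + 1) + (c w + 1)"
    using assms Cons by (simp add: sum.distrib)
  also have "(\<Sum>y\<in>A. \<Sum>x | (x, y) \<in> P. c x + 1) = (\<Sum>(y, x)\<in>(SIGMA y:A. {x. (x, y) \<in> P}). c x + 1)"
    using assms(1) finX by (subst sum.Sigma) auto
  also have "\<dots> = (\<Sum>(x, y)\<in>P. c x + 1)"
    using assms(2)
    by (intro sum.reindex_bij_witness[of _ "\<lambda>(x, y). (y, x)" "\<lambda>(x, y). (y, x)"])
       (auto simp: P_def Cons dest: set_zip_rightD)
  also have "\<dots> \<le> sum_list (map (\<lambda>(x, y). c x + 1) (zip ws (tl ws)))"
    unfolding P_def by (rule sum_set_le_sum_list)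
  also have "map (\<lambda>(x, y). c x + 1) (zip ws (tl ws)) = map (\<lambda>x. c x + 1) (butlast ws)"
    by (rule nth_equalityI) (auto simp: nth_butlast)
  also have "sum_list (map (\<lambda>x. c x + 1) (butlast ws)) \<le> sum_list (map (\<lambda>x. c x + 1) ws)"
    by (subst (2) append_butlast_last_id[symmetric]) (auto simp: Cons)
  also have "\<dots> = sum_list (map c ws) + length ws"
    using sum_list_addf[of c "\<lambda>_. 1" ws] by (simp add: sum_list_triv)
  finally show ?thesis
    using count_le_length[of ws w] by (simp add: c_def)
qed

lemma sum_lists_Suc:
  fixes g :: "'a list \<Rightarrow> 'b::comm_monoid_add"
  assumes "finite A"
  shows "(\<Sum>xs | set xs \<subseteq> A \<and> length xs = Suc n. g xs) =
    (\<Sum>ys | set ys \<subseteq> A \<and> length ys = n. \<Sum>x\<in>A. g (x # ys))"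
proof -
  have "{xs. set xs \<subseteq> A \<and> length xs = Suc n} =
      (\<lambda>(ys, x). x # ys) ` ({ys. set ys \<subseteq> A \<and> length ys = n} \<times> A)"
    by (auto simp: length_Suc_conv image_iff)
  moreover have "inj_on (\<lambda>(ys, x). x # ys) ({ys. set ys \<subseteq> A \<and> length ys = n} \<times> A)"
    by (auto simp: inj_on_def)
  ultimately show ?thesis
    by (simp add: sum.reindex sum.cartesian_product case_prod_unfold)
qed

text \<open>
  Two different positions of a uniform word carry the same letter with probability \<open>1 / card A\<close>, which
  suggests the bound \<open>n + n\<^sup>2 / card A\<close> for the mean number of coincidences. The inequality is multiplied
  by \<open>card A\<close> to stay within the natural numbers.
\<close>
lemma sum_coincidences_le:
  assumes "finite A"
  shows "card A * (\<Sum>xs | set xs \<subseteq> A \<and> length xs = n. sum_list (map (count_list xs) xs)) \<le>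
    card A ^ n * (n * card A + n ^ 2)"
proof (induction n)
  case 0
  have "{xs. set xs \<subseteq> A \<and> xs = []} = {[]}" by auto
  then show ?case by simp
next
  case (Suc n)
  let ?L = "{xs. set xs \<subseteq> A \<and> length xs = n}"
  have eq: "sum_list (map (count_list (x # xs)) (x # xs)) =
      sum_list (map (count_list xs) xs) + 2 * count_list xs x + 1" for x :: 'a and xs
  proof -
    have "sum_list (map (count_list (x # xs)) ys) =
        sum_list (map (count_list xs) ys) + count_list ys x" for ys
      by (induction ys) auto
    then show ?thesis by simp
  qed
  have "(\<Sum>xs | set xs \<subseteq> A \<and> length xs = Suc n. sum_list (map (count_list xs) xs)) =
      (\<Sum>xs\<in>?L. \<Sum>x\<in>A. sum_list (map (count_list xs) xs) + 2 * count_list xs x + 1)"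
    by (simp only: sum_lists_Suc[OF assms] eq)
  also have "\<dots> = (\<Sum>xs\<in>?L. card A * sum_list (map (count_list xs) xs) + (2 * n + card A))"
  proof (rule sum.cong[OF refl])
    fix xs assume "xs \<in> ?L"
    then have "(\<Sum>x\<in>A. count_list xs x) = n"
      using sum_count_set assms by fastforce
    then show "(\<Sum>x\<in>A. sum_list (map (count_list xs) xs) + 2 * count_list xs x + 1) =
        card A * sum_list (map (count_list xs) xs) + (2 * n + card A)"
      unfolding sum.distrib by (simp flip: sum_distrib_left)
  qed
  also have "\<dots> = card A * (\<Sum>xs\<in>?L. sum_list (map (count_list xs) xs)) +
      card A ^ n * (2 * n + card A)"
    by (simp add: sum.distrib sum_distrib_left card_lists_length_eq[OF assms])
  finally have "(\<Sum>xs | set xs \<subseteq> A \<and> length xs = Suc n. sum_list (map (count_list xs) xs)) \<le>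
      card A ^ n * (n * card A + n ^ 2) + card A ^ n * (2 * n + card A)"
    using Suc.IH by linarith
  also have "\<dots> \<le> card A ^ n * (Suc n * card A + Suc n ^ 2)"
    by (simp add: power2_eq_square algebra_simps)
  finally show ?case by (simp add: mult.assoc)
qed

text \<open>
  Bounds the error term of the recursion by dropping the restriction to trails, so that the first letter
  and the rest of the word can be summed independently. Relative to the \<open>card A ^ (n + 3)\<close> words for which it is an error, it has order
  \<open>1 / (card A)\<^sup>2\<close> when \<open>n\<close> is at most a multiple of \<open>card A\<close>.
\<close>
lemma sum_trails_used_preds_le:
  assumes "finite A"
  shows "card A * (\<Sum>xs\<in>trails A (Suc n). \<Sum>x\<in>used_preds xs. count_list xs x) \<le>
    card A ^ n * (3 * Suc n * card A + n ^ 2)"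
proof -
  let ?L = "{xs. set xs \<subseteq> A \<and> length xs = n}"
  have fin: "finite {xs. set xs \<subseteq> A \<and> length xs = Suc n}"
    using finite_lists_length_eq[OF assms] .
  have "(\<Sum>xs\<in>trails A (Suc n). \<Sum>x\<in>used_preds xs. count_list xs x) \<le>
      (\<Sum>xs | set xs \<subseteq> A \<and> length xs = Suc n. \<Sum>x\<in>used_preds xs. count_list xs x)"
    using fin by (intro sum_mono2) (auto simp: trails_def)
  also have "\<dots> = (\<Sum>ws\<in>?L. \<Sum>y\<in>A. \<Sum>x\<in>used_preds (y # ws). count_list (y # ws) x)"
    by (rule sum_lists_Suc[OF assms])
  also have "\<dots> \<le> (\<Sum>ws\<in>?L. sum_list (map (count_list ws) ws) + (2 * n + 1))"
    using sum_used_preds_le[OF assms] by (intro sum_mono) auto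
  also have "\<dots> = (\<Sum>ws\<in>?L. sum_list (map (count_list ws) ws)) + card A ^ n * (2 * n + 1)"
    unfolding sum.distrib by (simp add: card_lists_length_eq[OF assms])
  finally have le: "(\<Sum>xs\<in>trails A (Suc n). \<Sum>x\<in>used_preds xs. count_list xs x) \<le>
      (\<Sum>ws\<in>?L. sum_list (map (count_list ws) ws)) + card A ^ n * (2 * n + 1)" .
  have "card A * (\<Sum>xs\<in>trails A (Suc n). \<Sum>x\<in>used_preds xs. count_list xs x) \<le>
      card A * (\<Sum>ws\<in>?L. sum_list (map (count_list ws) ws)) + card A * (card A ^ n * (2 * n + 1))"
    using mult_le_mono2[OF le, of "card A"] by (simp only: distrib_left)
  also have "\<dots> \<le> card A ^ n * (n * card A + n ^ 2) + card A * (card A ^ n * (2 * n + 1))"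
    by (intro add_mono sum_coincidences_le[OF assms] order_refl)
  also have "\<dots> = card A ^ n * (n * card A + n ^ 2 + card A * (2 * n + 1))"
    by (simp only: distrib_left mult.left_commute)
  also have "\<dots> \<le> card A ^ n * (3 * Suc n * card A + n ^ 2)"
    by (intro mult_le_mono2) (simp add: algebra_simps)
  finally show ?thesis .
qed

text \<open>
  Both pieces of a trail that is cut in two are trails.
\<close>
lemma card_trails_add_le:
  assumes "finite A"
  shows "card (trails A (a + b)) \<le> card (trails A a) * card (trails A b)"
proof -
  have "(take a xs, drop a xs) \<in> trails A a \<times> trails A b" if "xs \<in> trails A (a + b)" for xs
  proof -
    have "zip (take a xs) (tl (take a xs)) = take (a - 1) (zip xs (tl xs))"
      by (rule nth_equalityI) (auto simp: nth_tl)
    moreover have "zip (drop a xs) (tl (drop a xs)) = drop a (zip xs (tl xs))"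
      by (simp add: drop_zip tl_drop)
    ultimately show ?thesis
      using that set_take_subset[of a xs] set_drop_subset[of a xs] by (auto simp: trails_def)
  qed
  moreover have "inj_on (\<lambda>xs. (take a xs, drop a xs)) (trails A (a + b))"
    by (rule inj_onI) (metis append_take_drop_id prod.inject)
  ultimately have "card (trails A (a + b)) \<le> card (trails A a \<times> trails A b)"
    using assms by (intro card_inj_on_le[where f = "\<lambda>xs. (take a xs, drop a xs)"]) auto
  then show ?thesis by (simp add: card_cartesian_product)
qed

section \<open>Gaussian asymptotics of the trail frequency\<close>

text \<open>
  The probability that a uniform word of length \<open>n\<close> over \<open>m\<close> letters is a trail.
\<close>
definition trail_freq :: "nat \<Rightarrow> nat \<Rightarrow> real" where
  "trail_freq m n = real (card (trails {1..m} n)) / real m ^ n"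

lemma trail_freq_nonneg: "0 \<le> trail_freq m n"
  by (simp add: trail_freq_def)

lemma trail_freq_le_1:
  assumes "m > 0"
  shows "trail_freq m n \<le> 1"
proof -
  have "card (trails {1..m} n) \<le> card {xs. set xs \<subseteq> {1..m} \<and> length xs = n}"
    by (intro card_mono finite_lists_length_eq) (auto simp: trails_def)
  then have "card (trails {1..m} n) \<le> m ^ n" by (simp add: card_lists_length_eq)
  then have "real (card (trails {1..m} n)) \<le> real m ^ n"
    by (simp flip: of_nat_power)
  then show ?thesis using assms by (simp add: trail_freq_def)
qed

lemma trail_freq_add_le: "trail_freq m (a + b) \<le> trail_freq m a * trail_freq m b"
proof -
  have "real (card (trails {1..m} (a + b))) \<le>
      real (card (trails {1..m} a)) * real (card (trails {1..m} b))"
    using card_trails_add_le[of "{1..m}" a b] by (simp flip: of_nat_mult)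
  then show ?thesis
    by (simp add: trail_freq_def power_add divide_right_mono)
qed

text \<open>
  A special case of submultiplicativity, as frequencies are at most 1.
\<close>
lemma trail_freq_antimono:
  assumes "m > 0" and "a \<le> b"
  shows "trail_freq m b \<le> trail_freq m a"
  using trail_freq_add_le[of m a "b - a"] assms trail_freq_le_1[OF assms(1), of "b - a"]
    trail_freq_nonneg[of m a] mult_left_le[of "trail_freq m (b - a)" "trail_freq m a"]
  by simp

lemma trail_freq_0: "trail_freq m 0 = 1"
  by (simp add: trail_freq_def)

lemma trail_freq_1:
  assumes "m > 0"
  shows "trail_freq m (Suc 0) = 1"
  using assms by (simp add: trail_freq_def trails_1 card_image inj_on_def)

lemma trail_freq_2:
  assumes "m > 0"
  shows "trail_freq m (Suc (Suc 0)) = 1"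
proof -
  have no_preds: "(\<Sum>xs\<in>trails {1..m} (Suc 0). count_list (tl xs) (hd xs)) = 0"
    by (auto simp: trails_1 intro!: sum.neutral)
  then have "int (card (trails {1..m} (Suc (Suc 0)))) = int m * int m"
    using card_trails_Suc[of "{1..m}" "Suc 0"] unfolding no_preds by (simp add: trails_1 card_image inj_on_def)
  then have "card (trails {1..m} (Suc (Suc 0))) = m * m"
    by (metis of_nat_eq_iff of_nat_mult)
  then show ?thesis using assms by (simp add: trail_freq_def)
qed

lemma trail_freq_recursion:
  assumes "m > 0"
  obtains e where "0 \<le> e" and "e \<le> (3 * real (Suc n) * real m + real n ^ 2) / real m ^ 4"
    and "trail_freq m (Suc (Suc (Suc n))) =
      trail_freq m (Suc (Suc n)) - real (Suc n) / real m ^ 2 * trail_freq m (Suc n) + e"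
proof
  let ?E = "\<Sum>xs\<in>trails {1..m} (Suc n). \<Sum>x\<in>used_preds xs. count_list xs x"
  let ?e = "real ?E / real m ^ Suc (Suc (Suc n))"
  show "0 \<le> ?e" by (rule divide_nonneg_nonneg[OF of_nat_0_le_iff zero_le_power[OF of_nat_0_le_iff]])
  have "m * ?E \<le> m ^ n * (3 * Suc n * m + n ^ 2)"
    using sum_trails_used_preds_le[of "{1..m}" n] by simp
  then have "real (m * ?E) \<le> real (m ^ n * (3 * Suc n * m + n ^ 2))"
    by (rule of_nat_mono)
  then have "real m * real ?E \<le> real m ^ n * (3 * real (Suc n) * real m + real n ^ 2)"
    by (simp only: of_nat_mult of_nat_add of_nat_power of_nat_numeral)
  then have "real m * real ?E / real m ^ (n + 4) \<le>
      real m ^ n * (3 * real (Suc n) * real m + real n ^ 2) / real m ^ (n + 4)"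
    by (rule divide_right_mono) simp
  moreover have "real m * real ?E / real m ^ (n + 4) = ?e"
    using assms by (simp add: eval_nat_numeral)
  moreover have "real m ^ n * (3 * real (Suc n) * real m + real n ^ 2) / real m ^ (n + 4) =
      (3 * real (Suc n) * real m + real n ^ 2) / real m ^ 4"
    using assms by (simp add: power_add)
  ultimately show "?e \<le> (3 * real (Suc n) * real m + real n ^ 2) / real m ^ 4" by simp
  have "real_of_int (int (card (trails {1..m} (Suc (Suc (Suc n)))))) =
      real_of_int (int m * int (card (trails {1..m} (Suc (Suc n)))) -
        int (Suc n) * int (card (trails {1..m} (Suc n))) + int ?E)"
    using card_trails_Suc_Suc[of "{1..m}" "Suc n"] by simp
  then have "real (card (trails {1..m} (Suc (Suc (Suc n))))) =
      real m * real (card (trails {1..m} (Suc (Suc n)))) -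
        real (Suc n) * real (card (trails {1..m} (Suc n))) + real ?E"
    by (simp only: of_int_add of_int_diff of_int_mult of_int_of_nat_eq)
  then show "trail_freq m (Suc (Suc (Suc n))) =
      trail_freq m (Suc (Suc n)) - real (Suc n) / real m ^ 2 * trail_freq m (Suc n) + ?e"
    using assms unfolding trail_freq_def
    by (simp add: add_divide_distrib diff_divide_distrib power2_eq_square del: of_nat_Suc)
qed

text \<open>
  In the recursion the error term only helps here. The bound allows the two consecutive frequencies
  in the recursion to be exchanged at a cost of order \<open>1 / m\<^sup>2\<close> when \<open>n = O(m)\<close>, which turns it into a
  first-order one.
\<close>
lemma trail_freq_decrement_le:
  assumes "m > 0"
  shows "trail_freq m (Suc n) - trail_freq m (Suc (Suc n)) \<le> real n / real m ^ 2"
proof (cases n)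
  case 0
  then show ?thesis using assms by (simp add: trail_freq_1 trail_freq_2)
next
  case (Suc k)
  obtain e where e: "0 \<le> e" "trail_freq m (Suc (Suc (Suc k))) =
      trail_freq m (Suc (Suc k)) - real (Suc k) / real m ^ 2 * trail_freq m (Suc k) + e"
    using trail_freq_recursion[OF assms] by metis
  have "real (Suc k) / real m ^ 2 * trail_freq m (Suc k) \<le> real (Suc k) / real m ^ 2"
    by (intro mult_left_le trail_freq_le_1[OF assms]) auto
  then show ?thesis using e Suc by simp
qed

text \<open>
  From \<open>1 + u \<le> exp u\<close>, as \<open>(1 - u + u\<^sup>2) (1 + u) = 1 + u\<^sup>3\<close>.
\<close>
lemma exp_minus_upper:
  fixes u :: real
  assumes "0 \<le> u"
  shows "exp (- u) \<le> 1 - u + u ^ 2"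
proof -
  have "1 \<le> (1 - u + u ^ 2) * (1 + u)"
    using assms by (simp add: algebra_simps power2_eq_square)
  also have "\<dots> \<le> (1 - u + u ^ 2) * exp u"
  proof (rule mult_left_mono)
    have "1 - u + u ^ 2 = (1 - u / 2) ^ 2 + 3 / 4 * u ^ 2"
      by (simp add: power2_eq_square algebra_simps)
    then show "0 \<le> 1 - u + u ^ 2" by simp
  qed simp
  finally show ?thesis by (simp add: exp_minus field_simps)
qed

text \<open>
  With \<open>a = (n + 1) / m\<^sup>2\<close>, both the frequency and the Gaussian are multiplied in one step by \<open>1 - a\<close>,
  up to errors of order \<open>1 / m\<^sup>2\<close>; and since \<open>0 \<le> 1 - a \<le> 1\<close>, the previous discrepancy is not
  amplified. The constant collects \<open>4 K\<^sup>2\<close> from the error term of the recursion, \<open>K\<^sup>2\<close> from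
  replacing \<open>p\<^sub>n\<^sub>+\<^sub>1\<close> by \<open>p\<^sub>n\<^sub>+\<^sub>2\<close>, and \<open>7 K\<^sup>2\<close> from the Gaussian, rounded up.
\<close>
lemma trail_freq_approx_step:
  assumes K: "1 \<le> K" "K \<le> real m" and n: "real (Suc n) \<le> K * real m"
  shows "\<bar>trail_freq m (Suc (Suc (Suc n))) - exp (- (real (Suc (Suc (Suc n))) ^ 2 / (2 * real m ^ 2)))\<bar>
    \<le> \<bar>trail_freq m (Suc (Suc n)) - exp (- (real (Suc (Suc n)) ^ 2 / (2 * real m ^ 2)))\<bar>
      + 14 * K ^ 2 / real m ^ 2"
proof -
  have m: "m > 0" "real m > 0" "real m \<ge> 1" using K by linarith+
  define M where "M = real m"
  define p where "p = trail_freq m"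
  define r where "r = (\<lambda>n. exp (- (real n ^ 2 / (2 * M ^ 2))))"
  define a where "a = real (Suc n) / M ^ 2"
  \<comment> \<open>The Gaussian loses the factor \<open>exp (- u)\<close>, because \<open>(n + 3)\<^sup>2 - (n + 2)\<^sup>2 = 2 n + 5\<close>.\<close>
  define u where "u = (2 * real n + 5) / (2 * M ^ 2)"
  have M: "M > 0" "M \<ge> 1" "K \<le> M" using m K by (auto simp: M_def)
  obtain e where e: "0 \<le> e" "e \<le> (3 * real (Suc n) * M + real n ^ 2) / M ^ 4"
    "p (Suc (Suc (Suc n))) = p (Suc (Suc n)) - a * p (Suc n) + e"
    using trail_freq_recursion[OF m(1), of n] unfolding M_def p_def a_def by metis
  have KM: "1 + real n \<le> K * M" using n by (simp add: M_def)
  have K2: "K \<le> K ^ 2" using K(1) by (simp add: power2_eq_square)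
  have a0: "0 \<le> a" using M by (simp add: a_def)
  have "a \<le> K * M / M ^ 2" unfolding a_def using KM by (intro divide_right_mono) auto
  also have aK: "K * M / M ^ 2 = K / M" using M by (simp add: power2_eq_square)
  finally have aK: "a \<le> K / M" .
  also have "\<dots> \<le> 1" using M by simp
  finally have a1: "a \<le> 1" .

  have "e \<le> (3 * (K * M) * M + (K * M) ^ 2) / M ^ 4"
    using e(2) KM M
    by (elim order_trans) (intro divide_right_mono add_mono mult_mono power_mono; simp)
  also have "\<dots> = (3 * K + K ^ 2) / M ^ 2"
    using M by (simp add: field_simps eval_nat_numeral)
  also have "\<dots> \<le> 4 * K ^ 2 / M ^ 2" using K2 by (intro divide_right_mono) auto
  finally have e4: "e \<le> 4 * K ^ 2 / M ^ 2" .

  have "p (Suc n) - p (Suc (Suc n)) \<le> real n / M ^ 2"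
    unfolding p_def M_def by (rule trail_freq_decrement_le[OF m(1)])
  also have "\<dots> \<le> a" unfolding a_def by (intro divide_right_mono) auto
  finally have "a * (p (Suc n) - p (Suc (Suc n))) \<le> a * a" using a0 by (rule mult_left_mono)
  also have "\<dots> \<le> K / M * (K / M)" using aK a0 by (intro mult_mono) auto
  also have "\<dots> = K ^ 2 / M ^ 2" by (simp add: power2_eq_square)
  finally have d1: "a * (p (Suc n) - p (Suc (Suc n))) \<le> K ^ 2 / M ^ 2" .
  have "p (Suc (Suc n)) \<le> p (Suc n)"
    unfolding p_def by (intro trail_freq_antimono m) auto
  then have d0: "0 \<le> a * (p (Suc n) - p (Suc (Suc n)))" using a0 by simp

  have r_step: "r (Suc (Suc (Suc n))) = r (Suc (Suc n)) * exp (- u)"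
    unfolding r_def u_def exp_add[symmetric]
    by (rule arg_cong[of _ _ exp]) (use M in \<open>simp add: field_simps power2_eq_square\<close>)
  have u0: "0 \<le> u" using M by (simp add: u_def)
  have "u \<le> 5 * K * M / (2 * M ^ 2)"
    unfolding u_def
  proof (intro divide_right_mono)
    have "1 \<le> K * M" using KM by simp
    then show "2 * real n + 5 \<le> 5 * K * M" using KM by (simp add: mult.assoc)
  qed simp
  also have "\<dots> = 5 / 2 * (K / M)" using M by (simp add: power2_eq_square)
  finally have "u ^ 2 \<le> (5 / 2 * (K / M)) ^ 2" using u0 by (intro power_mono) auto
  also have "\<dots> = (25 / 4 * K ^ 2) / M ^ 2"
    by (simp add: power_mult_distrib power_divide)
  also have "\<dots> \<le> 7 * K ^ 2 / M ^ 2"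
    by (intro divide_right_mono) auto
  finally have u2: "u ^ 2 \<le> 7 * K ^ 2 / M ^ 2" .
  have ua: "u = a + 3 / 2 / M ^ 2" using M by (simp add: u_def a_def field_simps)
  have K1: "3 / 2 / M ^ 2 \<le> 2 * K ^ 2 / M ^ 2"
    using K2 K(1) by (intro divide_right_mono) auto
  have E1: "exp (- u) - (1 - a) \<le> 7 * K ^ 2 / M ^ 2"
  proof -
    have "0 \<le> 3 / 2 / M ^ 2" by simp
    then show ?thesis using exp_minus_upper[OF u0] u2 ua by linarith
  qed
  have E2: "- (2 * K ^ 2 / M ^ 2) \<le> exp (- u) - (1 - a)"
    using exp_ge_add_one_self[of "- u"] ua K1 by linarith
  have r01: "0 \<le> r (Suc (Suc n))" "r (Suc (Suc n)) \<le> 1" by (auto simp: r_def)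
  have "\<bar>exp (- u) - (1 - a)\<bar> \<le> 7 * K ^ 2 / M ^ 2"
    using E1 E2 by (simp add: abs_le_iff field_simps)
  then have R: "\<bar>r (Suc (Suc n)) * (exp (- u) - (1 - a))\<bar> \<le> 7 * K ^ 2 / M ^ 2"
    using r01 mult_mono[of "r (Suc (Suc n))" 1 "\<bar>exp (- u) - (1 - a)\<bar>" "7 * K ^ 2 / M ^ 2"]
    by (simp add: abs_mult)

  have "p (Suc (Suc (Suc n))) - r (Suc (Suc (Suc n))) =
      (p (Suc (Suc n)) - r (Suc (Suc n))) * (1 - a) + e
      - a * (p (Suc n) - p (Suc (Suc n))) - r (Suc (Suc n)) * (exp (- u) - (1 - a))"
    unfolding e(3) r_step by (simp add: algebra_simps)
  moreover have "\<bar>(p (Suc (Suc n)) - r (Suc (Suc n))) * (1 - a)\<bar> \<le> \<bar>p (Suc (Suc n)) - r (Suc (Suc n))\<bar>"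
    using a0 a1 by (simp add: abs_mult mult_left_le)
  moreover have "7 * K ^ 2 / M ^ 2 + 4 * K ^ 2 / M ^ 2 + K ^ 2 / M ^ 2 \<le> 14 * K ^ 2 / M ^ 2"
    by (simp flip: add_divide_distrib add: divide_right_mono)
  ultimately have "\<bar>p (Suc (Suc (Suc n))) - r (Suc (Suc (Suc n)))\<bar>
      \<le> \<bar>p (Suc (Suc n)) - r (Suc (Suc n))\<bar> + 14 * K ^ 2 / M ^ 2"
    using e4 e(1) d0 d1 R by linarith
  then show ?thesis by (simp only: p_def r_def M_def)
qed

text \<open>
  At most \<open>K m\<close> errors of size \<open>14 K\<^sup>2 / m\<^sup>2\<close> accumulate; the factor 2 in \<open>28 = 2 * 14\<close> leaves room
  for the discrepancy at the start.
\<close>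
lemma trail_freq_approx:
  assumes K: "1 \<le> K" "K \<le> real m" and n: "real n \<le> K * real m"
  shows "\<bar>trail_freq m n - exp (- (real n ^ 2 / (2 * real m ^ 2)))\<bar> \<le> 28 * K ^ 3 / real m"
proof -
  have m: "m > 0" "real m > 0" using K by linarith+
  let ?D = "\<lambda>n. \<bar>trail_freq m n - exp (- (real n ^ 2 / (2 * real m ^ 2)))\<bar>"
  have K2: "1 \<le> K ^ 2" using K(1) by simp
  have small: "?D n \<le> 14 * K ^ 2 * real (Suc n) / real m ^ 2"
    if "trail_freq m n = 1" "n \<le> 2" for n
  proof -
    let ?u = "(real n) ^ 2 / (2 * real m ^ 2)"
    have "?D n = 1 - exp (- ?u)" using that by simp
    also have "\<dots> \<le> ?u" using exp_ge_add_one_self[of "- ?u"] by linarith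
    also have "\<dots> = (real n ^ 2 / 2) / real m ^ 2" by simp
    also have "\<dots> \<le> 14 * K ^ 2 * real (Suc n) / real m ^ 2"
    proof (rule divide_right_mono)
      have "real n ^ 2 \<le> 2 ^ 2" using that by (intro power_mono) auto
      moreover have "1 \<le> K ^ 2 * real (Suc n)" using mult_mono[OF K2, of 1 "real (Suc n)"] by simp
      ultimately show "real n ^ 2 / 2 \<le> 14 * K ^ 2 * real (Suc n)" by simp
    qed simp
    finally show ?thesis .
  qed
  have "real n \<le> K * real m \<Longrightarrow> ?D n \<le> 14 * K ^ 2 * real (Suc n) / real m ^ 2" for n
  proof (induction n)
    case 0
    then show ?case using small[of 0] by (simp add: trail_freq_0)
  next
    case (Suc n)
    show ?case
    proof (cases "n < 2")
      case True
      then have "n = 0 \<or> n = 1" by linarith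
      then show ?thesis
        using small[of "Suc n"] trail_freq_1[OF m(1)] trail_freq_2[OF m(1)] by auto
    next
      case False
      then obtain k where k: "n = Suc (Suc k)"
        by (metis Suc_1 add_2_eq_Suc le_add_diff_inverse not_less)
      have "?D (Suc n) \<le> ?D n + 14 * K ^ 2 / real m ^ 2"
        unfolding k using Suc.prems by (intro trail_freq_approx_step K) (simp add: k)
      also have "?D n \<le> 14 * K ^ 2 * real (Suc n) / real m ^ 2"
        using Suc by simp
      finally show ?thesis by (simp add: algebra_simps add_divide_distrib)
    qed
  qed
  from this[OF n] have "?D n \<le> 14 * K ^ 2 * real (Suc n) / real m ^ 2" .
  also have "\<dots> \<le> 14 * K ^ 2 * (2 * K * real m) / real m ^ 2"
  proof (intro divide_right_mono mult_left_mono)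
    have "1 \<le> K * real m" using mult_mono[of 1 K 1 "real m"] K by simp
    then show "real (Suc n) \<le> 2 * K * real m" using n by simp
  qed auto
  also have "\<dots> = 28 * K ^ 3 / real m"
    using m by (simp add: eval_nat_numeral)
  finally show ?thesis .
qed

text \<open>
  The scale \<open>\<surd>2 m\<close> is the one on which \<open>n\<^sup>2 / (2 m\<^sup>2)\<close> becomes \<open>y\<^sup>2\<close>.
\<close>
lemma trail_freq_tendsto:
  assumes "0 \<le> y"
  shows "(\<lambda>m. trail_freq m (nat \<lfloor>sqrt 2 * real m * y\<rfloor>)) \<longlonglongrightarrow> exp (- (y ^ 2))"
proof -
  define k where "k = (\<lambda>m::nat. nat \<lfloor>sqrt 2 * real m * y\<rfloor>)"
  define K where "K = sqrt 2 * y + 1"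
  have k: "real (k m) \<le> sqrt 2 * real m * y" "sqrt 2 * real m * y - 1 \<le> real (k m)" for m
    using assms by (auto simp: k_def of_nat_nat)
  have "(\<lambda>m. real (k m) / real m) \<longlonglongrightarrow> sqrt 2 * y"
  proof (rule tendsto_sandwich)
    show "\<forall>\<^sub>F m in sequentially. sqrt 2 * y - 1 / real m \<le> real (k m) / real m"
      using eventually_gt_at_top[of 0]
    proof eventually_elim
      case (elim m)
      then have "sqrt 2 * y - 1 / real m = (sqrt 2 * real m * y - 1) / real m"
        by (simp add: field_simps)
      then show ?case using k(2)[of m] by (simp add: divide_right_mono)
    qed
    show "\<forall>\<^sub>F m in sequentially. real (k m) / real m \<le> sqrt 2 * y"
      using eventually_gt_at_top[of 0]
      by eventually_elim (use k(1) in \<open>simp add: divide_le_eq mult_ac\<close>)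
    have "(\<lambda>m. sqrt 2 * y - 1 / real m) \<longlonglongrightarrow> sqrt 2 * y - 0"
      by (intro tendsto_intros lim_1_over_n)
    then show "(\<lambda>m. sqrt 2 * y - 1 / real m) \<longlonglongrightarrow> sqrt 2 * y" by simp
  qed simp
  then have "(\<lambda>m. exp (- ((real (k m) / real m) ^ 2 / 2))) \<longlonglongrightarrow> exp (- ((sqrt 2 * y) ^ 2 / 2))"
    by (intro tendsto_intros) simp_all
  then have lim: "(\<lambda>m. exp (- (real (k m) ^ 2 / (2 * real m ^ 2)))) \<longlonglongrightarrow> exp (- (y ^ 2))"
    by (simp add: power_mult_distrib power_divide mult.commute)
  have "(\<lambda>m. trail_freq m (k m) - exp (- (real (k m) ^ 2 / (2 * real m ^ 2)))) \<longlonglongrightarrow> 0"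
  proof (rule Lim_null_comparison)
    have "eventually (\<lambda>m. K \<le> real m) sequentially"
      using filterlim_real_sequentially by (simp add: filterlim_at_top)
    then show "\<forall>\<^sub>F m in sequentially. norm (trail_freq m (k m) -
        exp (- (real (k m) ^ 2 / (2 * real m ^ 2)))) \<le> 28 * K ^ 3 / real m"
    proof eventually_elim
      case (elim m)
      have "1 \<le> K" using assms by (simp add: K_def)
      moreover have "real (k m) \<le> K * real m"
        using k(1)[of m] by (simp add: K_def algebra_simps)
      ultimately show ?case using trail_freq_approx[of K m "k m"] elim by simp
    qed
    show "(\<lambda>m. 28 * K ^ 3 / real m) \<longlonglongrightarrow> 0"
      using tendsto_mult_right_zero[OF lim_1_over_n, of "28 * K ^ 3"] by simp
  qed
  from tendsto_add[OF this lim] show ?thesis by (simp add: k_def)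
qed

lemma trail_freq_mult_le: "trail_freq m (j * n) \<le> trail_freq m n ^ j"
proof (induction j)
  case 0
  then show ?case by (simp add: trail_freq_0)
next
  case (Suc j)
  have "trail_freq m (Suc j * n) \<le> trail_freq m n * trail_freq m (j * n)"
    using trail_freq_add_le[of m n "j * n"] by simp
  also have "\<dots> \<le> trail_freq m n * trail_freq m n ^ j"
    by (intro mult_left_mono Suc trail_freq_nonneg)
  finally show ?case by simp
qed

text \<open>
  Once the frequency at length \<open>2 m\<close> is at most \<open>exp (- 1)\<close>, which it eventually is because its
  limit is \<open>exp (- 2)\<close>, each further block of length \<open>2 m\<close> costs another factor \<open>exp (- 1)\<close>. A word of
  length \<open>\<surd>2 m y\<close> contains about \<open>y / \<surd>2\<close> such blocks.
\<close>
lemma trail_freq_exp_tail: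
  "\<forall>\<^sub>F m in sequentially. \<forall>y\<ge>0. trail_freq m (nat \<lfloor>sqrt 2 * real m * y\<rfloor>) \<le> exp (1 - y / 2)"
proof -
  have "exp (- (sqrt 2 ^ 2)) < exp (- 1 :: real)" by simp
  from order_tendstoD(2)[OF trail_freq_tendsto[of "sqrt 2"] this]
  moreover have "nat \<lfloor>sqrt 2 * real m * sqrt 2\<rfloor> = 2 * m" for m
  proof -
    have "sqrt 2 * real m * sqrt 2 = real (2 * m)" by simp
    then show ?thesis by (metis floor_of_nat nat_int)
  qed
  ultimately have "\<forall>\<^sub>F m in sequentially. trail_freq m (2 * m) < exp (- 1)" by simp
  with eventually_gt_at_top[of 0] show ?thesis
  proof eventually_elim
    case (elim m)
    show ?case
    proof (intro allI impI)
      fix y :: real assume y: "0 \<le> y"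
      define j where "j = nat \<lfloor>y / sqrt 2\<rfloor>"
      have j: "real j \<le> y / sqrt 2" "y / sqrt 2 - 1 \<le> real j"
        using y by (auto simp: j_def of_nat_nat)
      have "real (j * (2 * m)) = real j * (sqrt 2 * (sqrt 2 * real m))"
        by (simp flip: mult.assoc)
      also have "\<dots> \<le> y / sqrt 2 * (sqrt 2 * (sqrt 2 * real m))"
        using j by (intro mult_right_mono) auto
      also have "\<dots> = sqrt 2 * real m * y" by simp
      finally have "j * (2 * m) \<le> nat \<lfloor>sqrt 2 * real m * y\<rfloor>"
        by (simp add: le_nat_floor)
      then have "trail_freq m (nat \<lfloor>sqrt 2 * real m * y\<rfloor>) \<le> trail_freq m (j * (2 * m))"
        using elim by (intro trail_freq_antimono) auto
      also have "\<dots> \<le> trail_freq m (2 * m) ^ j" by (rule trail_freq_mult_le)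
      also have "\<dots> \<le> exp (- 1) ^ j"
        using elim trail_freq_nonneg by (intro power_mono) auto
      also have "\<dots> = exp (- real j)" by (simp flip: exp_of_nat_mult)
      also have "\<dots> \<le> exp (1 - y / sqrt 2)" using j by simp
      also have "\<dots> \<le> exp (1 - y / 2)"
      proof -
        have "sqrt 2 \<le> sqrt 4" by (intro real_sqrt_le_mono) simp
        then have "sqrt 2 \<le> 2" by simp
        then have "y / 2 \<le> y / sqrt 2" using y by (intro divide_left_mono) auto
        then show ?thesis by simp
      qed
      finally show "trail_freq m (nat \<lfloor>sqrt 2 * real m * y\<rfloor>) \<le> exp (1 - y / 2)" .
    qed
  qed
qed

section \<open>The law of the repetition time\<close>

text \<open>
  Prescribing the values at \<open>k\<close> different points leaves the other \<open>card S - k\<close> values free.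
\<close>
lemma card_PiE_prescribed:
  assumes "finite S" and "finite A" and "inj_on s {..<k}"
    and "s ` {..<k} \<subseteq> S" and "v ` {..<k} \<subseteq> A"
  shows "card {f \<in> S \<rightarrow>\<^sub>E A. \<forall>i<k. f (s i) = v i} * card A ^ k = card A ^ card S"
proof -
  let ?D = "s ` {..<k}"
  let ?w = "\<lambda>p. v (inv_into {..<k} s p)"
  have w: "?w (s i) = v i" if "i < k" for i
    using that assms(3) by simp
  have "{f \<in> S \<rightarrow>\<^sub>E A. \<forall>i<k. f (s i) = v i} = (\<Pi>\<^sub>E p\<in>S. if p \<in> ?D then {?w p} else A)"
  proof (intro equalityI subsetI)
    fix f assume f: "f \<in> {f \<in> S \<rightarrow>\<^sub>E A. \<forall>i<k. f (s i) = v i}"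
    then show "f \<in> (\<Pi>\<^sub>E p\<in>S. if p \<in> ?D then {?w p} else A)"
      using w by (auto simp: PiE_iff)
  next
    fix f assume f: "f \<in> (\<Pi>\<^sub>E p\<in>S. if p \<in> ?D then {?w p} else A)"
    have val: "f (s i) = v i" if "i < k" for i
    proof -
      have "s i \<in> S" "s i \<in> ?D" using that assms(4) by auto
      then show ?thesis using f w[OF that] by (auto simp: PiE_iff)
    qed
    moreover have "f p \<in> A" if "p \<in> S" for p
    proof (cases "p \<in> ?D")
      case True
      then show ?thesis using val assms(5) by auto
    next
      case False
      then show ?thesis using that f by (auto simp: PiE_iff)
    qed
    ultimately show "f \<in> {f \<in> S \<rightarrow>\<^sub>E A. \<forall>i<k. f (s i) = v i}"
      using f by (auto simp: PiE_iff)
  qed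
  then have "card {f \<in> S \<rightarrow>\<^sub>E A. \<forall>i<k. f (s i) = v i} =
      (\<Prod>p\<in>S. card (if p \<in> ?D then {?w p} else A))"
    using card_PiE[OF assms(1)] by metis
  also have "\<dots> = (\<Prod>p\<in>S. if p \<in> ?D then 1 else card A)"
    by (intro prod.cong) auto
  also have "\<dots> = card A ^ card (S - ?D)"
    using assms(1) by (simp add: prod.If_cases Diff_eq)
  finally have "card {f \<in> S \<rightarrow>\<^sub>E A. \<forall>i<k. f (s i) = v i} = card A ^ card (S - ?D)" .
  moreover have "card (S - ?D) + k = card S"
    using assms card_mono[OF assms(1,4)] by (simp add: card_Diff_subset card_image)
  ultimately show ?thesis by (metis power_add)
qed

definition outcomes :: "nat \<Rightarrow> outcome set" where
  "outcomes m = (({1..m} \<times> {1..m}) \<rightarrow>\<^sub>E {1..m}) \<times> ({1..m} \<times> {1..m})"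

lemma finite_outcomes: "finite (outcomes m)"
  by (auto simp: outcomes_def intro!: finite_PiE)

lemma outcomes_nonempty: "m > 0 \<Longrightarrow> outcomes m \<noteq> {}"
  by (auto simp: outcomes_def PiE_eq_empty_iff)

lemma card_outcomes: "card (outcomes m) = m ^ (m * m) * (m * m)"
  by (simp add: outcomes_def card_cartesian_product card_PiE)

lemma model_eq_pmf_of_set:
  assumes "m > 0"
  shows "model m = pmf_of_set (outcomes m)"
proof (rule pmf_eqI)
  fix \<omega> :: outcome
  let ?S = "{1..m} \<times> {1..m}" and ?F = "({1..m} \<times> {1..m}) \<rightarrow>\<^sub>E {1..m}"
  have F: "finite ?F" "?F \<noteq> {}" and S: "finite ?S" "?S \<noteq> {}"
    using assms by (auto simp: PiE_eq_empty_iff intro!: finite_PiE)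
  have "pmf (model m) \<omega> = indicator ?F (fst \<omega>) / card ?F * (indicator ?S (snd \<omega>) / card ?S)"
    using F S by (cases \<omega>) (simp only: model_def pmf_pair pmf_of_set[OF F(2,1)] pmf_of_set[OF S(2,1)] fst_conv snd_conv)
  also have "\<dots> = indicator (outcomes m) \<omega> / card (outcomes m)"
    unfolding outcomes_def card_cartesian_product by (cases \<omega>) (simp add: indicator_times)
  also have "\<dots> = pmf (pmf_of_set (outcomes m)) \<omega>"
    by (rule pmf_of_set[symmetric]) (use assms finite_outcomes outcomes_nonempty in auto)
  finally show "pmf (model m) \<omega> = pmf (pmf_of_set (outcomes m)) \<omega>" .
qed

lemma set_pmf_model: "m > 0 \<Longrightarrow> set_pmf (model m) = outcomes m"
  by (simp add: model_eq_pmf_of_set finite_outcomes outcomes_nonempty)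

text \<open>
  The word \<open>X\<^sub>1 \<dots> X\<^sub>n\<close>; positions in the list start at 0, the indices of the sequence at 1.
\<close>
definition X_prefix :: "outcome \<Rightarrow> nat \<Rightarrow> nat list" where
  "X_prefix \<omega> n = map (\<lambda>i. X_seq \<omega> (Suc i)) [0..<n]"

lemma X_prefix_eq_iff:
  assumes "length xs = Suc (Suc k)"
  shows "X_prefix (f, (a, b)) (Suc (Suc k)) = xs \<longleftrightarrow>
    a = xs ! 0 \<and> b = xs ! 1 \<and> (\<forall>i<k. f (xs ! i, xs ! Suc i) = xs ! Suc (Suc i))"
    (is "?lhs \<longleftrightarrow> ?rhs")
proof -
  let ?X = "X_seq (f, (a, b))"
  have eq: "?lhs \<longleftrightarrow> (\<forall>i<Suc (Suc k). ?X (Suc i) = xs ! i)"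
    using assms by (auto simp: X_prefix_def list_eq_iff_nth_eq simp del: upt_Suc)
  show ?thesis
  proof
    assume ?lhs
    then have X: "?X (Suc i) = xs ! i" if "i < Suc (Suc k)" for i
      using eq that by blast
    have "f (xs ! i, xs ! Suc i) = xs ! Suc (Suc i)" if "i < k" for i
      using X[of i] X[of "Suc i"] X[of "Suc (Suc i)"] that by simp
    then show ?rhs using X[of 0] X[of 1] by simp
  next
    assume rhs: ?rhs
    have "i < Suc (Suc k) \<longrightarrow> ?X (Suc i) = xs ! i" for i
    proof (induction i rule: less_induct)
      case (less i)
      consider "i = 0" | "i = 1" | j where "i = Suc (Suc j)"
        by (metis One_nat_def not0_implies_Suc)
      then show ?case
      proof cases
        case 3
        then show ?thesis using less[of j] less[of "Suc j"] rhs by simp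
      qed (use rhs in auto)
    qed
    then show ?lhs using eq by blast
  qed
qed

lemma X_seq_mem:
  assumes "\<omega> \<in> outcomes m"
  shows "X_seq \<omega> (Suc i) \<in> {1..m}"
proof (induction i rule: less_induct)
  case (less i)
  consider "i = 0" | "i = 1" | j where "i = Suc (Suc j)"
    by (metis One_nat_def not0_implies_Suc)
  then show ?case
  proof cases
    case 3
    then have "(X_seq \<omega> (Suc j), X_seq \<omega> (Suc (Suc j))) \<in> {1..m} \<times> {1..m}"
      using less[of j] less[of "Suc j"] by auto
    then show ?thesis using assms 3 by (auto simp: outcomes_def PiE_iff)
  qed (use assms in \<open>auto simp: outcomes_def\<close>)
qed

text \<open>
  The pigeonhole principle is used first: the pairs take finitely many values, so a repetition
  exists and the least element in the definition of \<open>tau\<close> is attained. The repetition at time \<open>tau\<close>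
  is completed by the letter with that index, hence the pairs inside the first \<open>n\<close> letters decide.
\<close>
lemma tau_gt_iff:
  assumes "\<omega> \<in> outcomes m" and "n \<ge> 2"
  shows "n < tau \<omega> \<longleftrightarrow> X_prefix \<omega> n \<in> trails {1..m} n"
proof -
  let ?Q = "\<lambda>t. \<exists>j. 1 \<le> j \<and> j < t - 1 \<and> W_seq \<omega> (t - 1) = W_seq \<omega> j"
  let ?w = "\<lambda>i. W_seq \<omega> (Suc i)"
  have Q: "?Q (Suc (Suc k))" if "i < k" "?w i = ?w k" for i k
    using that by (intro exI[of _ "Suc i"]) auto
  have "?w ` UNIV \<subseteq> {1..m} \<times> {1..m}"
    using X_seq_mem[OF assms(1)] by (auto simp: W_seq_def)
  then have "finite (range ?w)" by (rule finite_subset) simp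
  then have "\<not> inj ?w" by (metis finite_imageD infinite_UNIV_nat)
  then obtain i k where "?w i = ?w k" "i \<noteq> k" by (auto simp: inj_def)
  then have "\<exists>t. ?Q t" using Q[of i k] Q[of k i] by (metis linorder_neqE_nat)
  then have Qtau: "?Q (tau \<omega>)" unfolding tau_def by (rule LeastI_ex)
  have "tau \<omega> \<le> n \<longleftrightarrow> (\<exists>t\<le>n. ?Q t)"
    using Qtau Least_le[of ?Q] unfolding tau_def by (meson order_trans)
  also have "\<dots> \<longleftrightarrow> (\<exists>k<n - 1. \<exists>i<k. ?w i = ?w k)"
  proof
    assume "\<exists>t\<le>n. ?Q t"
    then obtain t j where t: "t \<le> n" "1 \<le> j" "j < t - 1" "W_seq \<omega> (t - 1) = W_seq \<omega> j" by auto
    define k i where "k = t - 2" and "i = j - 1"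
    have "t = Suc (Suc k)" "j = Suc i" using t unfolding k_def i_def by linarith+
    then show "\<exists>k<n - 1. \<exists>i<k. ?w i = ?w k"
      using t by (intro exI[of _ k] conjI exI[of _ i]) auto
  next
    assume "\<exists>k<n - 1. \<exists>i<k. ?w i = ?w k"
    then obtain k i where "k < n - 1" "i < k" "?w i = ?w k" by auto
    then show "\<exists>t\<le>n. ?Q t" using Q[of i k] by (intro exI[of _ "Suc (Suc k)"]) auto
  qed
  also have "\<dots> \<longleftrightarrow> \<not> distinct (map ?w [0..<n - 1])"
  proof -
    have "(\<exists>k<N. \<exists>i<k. g i = g k) \<longleftrightarrow> \<not> (\<forall>i<N. \<forall>k<N. i \<noteq> k \<longrightarrow> g i \<noteq> g k)"
      for N and g :: "nat \<Rightarrow> nat \<times> nat"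
      by (metis linorder_neqE_nat order.strict_trans nat_neq_iff)
    then show ?thesis by (simp add: distinct_conv_nth)
  qed
  also have "map ?w [0..<n - 1] = zip (X_prefix \<omega> n) (tl (X_prefix \<omega> n))"
    by (rule nth_equalityI) (auto simp: X_prefix_def nth_tl W_seq_def)
  finally show ?thesis
    using X_seq_mem[OF assms(1)] by (auto simp: trails_def X_prefix_def not_le[symmetric])
qed

text \<open>
  A trail of length \<open>k + 2\<close> fixes the starting pair and prescribes \<open>f\<close> at its first \<open>k\<close> pairs. They
  are different, so the prescriptions are independent. This is where it matters that the word is
  a trail.
\<close>
lemma card_outcomes_X_prefix:
  assumes "xs \<in> trails {1..m} (Suc (Suc k))"
  shows "card {\<omega> \<in> outcomes m. X_prefix \<omega> (Suc (Suc k)) = xs} * m ^ k = m ^ (m * m)"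
proof -
  let ?S = "{1..m} \<times> {1..m}"
  let ?s = "\<lambda>i. (xs ! i, xs ! Suc i)"
  let ?F = "{f \<in> ?S \<rightarrow>\<^sub>E {1..m}. \<forall>i<k. f (?s i) = xs ! Suc (Suc i)}"
  have len: "length xs = Suc (Suc k)" and sub: "set xs \<subseteq> {1..m}"
    and dist: "distinct (zip xs (tl xs))"
    using assms by (auto simp: trails_def)
  have mem: "xs ! i \<in> {1..m}" if "i < Suc (Suc k)" for i
    using len that by (intro subsetD[OF sub] nth_mem) simp
  have "{\<omega> \<in> outcomes m. X_prefix \<omega> (Suc (Suc k)) = xs} = ?F \<times> {(xs ! 0, xs ! 1)}"
  proof (rule set_eqI)
    fix \<omega> :: outcome
    obtain f a b where \<omega>: "\<omega> = (f, (a, b))" by (metis prod.exhaust)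
    show "\<omega> \<in> {\<omega> \<in> outcomes m. X_prefix \<omega> (Suc (Suc k)) = xs} \<longleftrightarrow> \<omega> \<in> ?F \<times> {(xs ! 0, xs ! 1)}"
      unfolding \<omega> mem_Collect_eq X_prefix_eq_iff[OF len] outcomes_def
      using mem[of 0] mem[of 1] by auto
  qed
  then have "card {\<omega> \<in> outcomes m. X_prefix \<omega> (Suc (Suc k)) = xs} = card ?F"
    by (simp add: card_cartesian_product)
  moreover have "card ?F * card {1..m} ^ k = card {1..m} ^ card ?S"
  proof (rule card_PiE_prescribed)
    show "inj_on ?s {..<k}"
    proof (rule inj_onI)
      fix i j assume ij: "i \<in> {..<k}" "j \<in> {..<k}" "?s i = ?s j"
      then have "zip xs (tl xs) ! i = zip xs (tl xs) ! j"
        using len by (simp add: nth_tl)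
      then show "i = j" using nth_eq_iff_index_eq[OF dist, of i j] ij len by simp
    qed
    show "?s ` {..<k} \<subseteq> ?S" using mem by fastforce
    show "(\<lambda>i. xs ! Suc (Suc i)) ` {..<k} \<subseteq> {1..m}" using mem by fastforce
  qed auto
  ultimately show ?thesis by (simp add: card_cartesian_product)
qed

lemma prob_tau_gt:
  assumes "m > 0"
  shows "measure_pmf.prob (model m) {\<omega>. n < tau \<omega>} = trail_freq m n"
proof -
  have gen: "measure_pmf.prob (model m) {\<omega>. Suc (Suc k) < tau \<omega>} = trail_freq m (Suc (Suc k))" for k
  proof -
    let ?n = "Suc (Suc k)"
    let ?B = "\<lambda>xs. {\<omega> \<in> outcomes m. X_prefix \<omega> ?n = xs}"
    have cB: "real (card (?B xs)) = real m ^ (m * m) / real m ^ k" if "xs \<in> trails {1..m} ?n" for xs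
    proof -
      have "real (card (?B xs)) * real m ^ k = real m ^ (m * m)"
        using arg_cong[OF card_outcomes_X_prefix[OF that], of real]
        by (simp only: of_nat_mult of_nat_power)
      moreover have "real m ^ k \<noteq> 0" using assms by simp
      ultimately show ?thesis by (simp only: nonzero_eq_divide_eq not_False_eq_True)
    qed
    have "outcomes m \<inter> {\<omega>. ?n < tau \<omega>} = (\<Union>xs\<in>trails {1..m} ?n. ?B xs)"
      using tau_gt_iff[of _ m ?n] by auto
    then have "real (card (outcomes m \<inter> {\<omega>. ?n < tau \<omega>})) = real (\<Sum>xs\<in>trails {1..m} ?n. card (?B xs))"
      using finite_outcomes by (subst card_UN_disjoint[symmetric]) auto
    also have "\<dots> = real (card (trails {1..m} ?n)) * (real m ^ (m * m) / real m ^ k)"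
      by (simp add: cB)
    finally have "real (card (outcomes m \<inter> {\<omega>. ?n < tau \<omega>})) =
        real (card (trails {1..m} ?n)) * (real m ^ (m * m) / real m ^ k)" .
    then have "measure_pmf.prob (model m) {\<omega>. ?n < tau \<omega>} =
        real (card (trails {1..m} ?n)) * (real m ^ (m * m) / real m ^ k) / (real m ^ (m * m) * (real m * real m))"
      using measure_pmf_of_set[OF outcomes_nonempty[OF assms] finite_outcomes, of "{\<omega>. ?n < tau \<omega>}"]
      by (simp only: model_eq_pmf_of_set[OF assms] card_outcomes of_nat_mult of_nat_power)
    moreover have "N * (a / b) / (a * (c * c)) = N / (c * (c * b))"
      if "a \<noteq> 0" "b \<noteq> 0" "c \<noteq> 0" for N a b c :: real
      using that by (simp add: field_simps)
    ultimately show ?thesis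
      using assms by (simp only: trail_freq_def power_Suc) simp
  qed
  show ?thesis
  proof (cases "n < 2")
    case True
    \<comment> \<open>The event for \<open>n < 2\<close> contains the event for 2, which has probability 1.\<close>
    have "trail_freq m n = 1"
      using True trail_freq_0[of m] trail_freq_1[OF assms] by (cases n) (auto simp: less_Suc_eq)
    moreover have "1 \<le> measure_pmf.prob (model m) {\<omega>. n < tau \<omega>}"
      unfolding trail_freq_2[OF assms, symmetric] gen[symmetric]
      using True by (intro measure_pmf.finite_measure_mono) auto
    ultimately show ?thesis using measure_pmf.prob_le_1 by (metis order_antisym)
  next
    case False
    then show ?thesis using gen[of "n - 2"] by (simp add: numeral_2_eq_2 Suc_diff_Suc)
  qed
qed

section \<open>Convergence of moments from tails\<close>

text \<open>
  Finite support turns the exchange of expectation and integral into linearity; each outcome contributes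
  \<open>Y ^ (r + 1)\<close>, the integral of the derivative of \<open>y ^ (r + 1)\<close> from \<open>0\<close> to \<open>Y\<close>.
\<close>
lemma pmf_power_moment_layer_cake:
  fixes Y :: "'a \<Rightarrow> real"
  assumes fin: "finite (set_pmf M)" and nonneg: "\<And>\<omega>. 0 \<le> Y \<omega>"
  shows "measure_pmf.expectation M (\<lambda>\<omega>. Y \<omega> ^ Suc r) =
    (\<integral>y. indicator {0..} y * (real (Suc r) * y ^ r * measure_pmf.prob M {\<omega>. y < Y \<omega>}) \<partial>lborel)"
proof -
  let ?h = "\<lambda>\<omega> y. (real (Suc r) * y ^ r) * indicator {0..Y \<omega>} y"
  let ?g = "\<lambda>\<omega> y. pmf M \<omega> * (indicator {0..<Y \<omega>} y * (real (Suc r) * y ^ r))"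
  have h: "has_bochner_integral lborel (?h \<omega>) (Y \<omega> ^ Suc r)" for \<omega>
  proof -
    have "has_bochner_integral lborel (?h \<omega>) (Y \<omega> ^ Suc r - 0 ^ Suc r)"
    proof (rule has_bochner_integral_FTC_Icc_real[OF nonneg])
      show "((\<lambda>y. y ^ Suc r) has_field_derivative real (Suc r) * y ^ r) (at y)" for y :: real
        using DERIV_pow[of "Suc r" y] by simp
    qed (auto intro!: continuous_intros)
    then show ?thesis by simp
  qed
  \<comment> \<open>The right end point is a null set; removing it matches the strict inequality in the tail.\<close>
  have "has_bochner_integral lborel (\<lambda>y. indicator {0..<Y \<omega>} y * (real (Suc r) * y ^ r)) (Y \<omega> ^ Suc r)" for \<omega>
  proof (rule has_bochner_integral_cong_AE[THEN iffD1, OF _ _ _ h])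
    show "AE y in lborel. ?h \<omega> y = indicator {0..<Y \<omega>} y * (real (Suc r) * y ^ r)"
      using AE_lborel_singleton[of "Y \<omega>"] by eventually_elim (auto simp: indicator_def)
  qed auto
  then have g: "has_bochner_integral lborel (?g \<omega>) (pmf M \<omega> * Y \<omega> ^ Suc r)" for \<omega>
    by (rule has_bochner_integral_mult_right)
  have "(\<integral>y. indicator {0..} y * (real (Suc r) * y ^ r * measure_pmf.prob M {\<omega>. y < Y \<omega>}) \<partial>lborel) =
      (\<integral>y. (\<Sum>\<omega>\<in>set_pmf M. ?g \<omega> y) \<partial>lborel)"
  proof (rule Bochner_Integration.integral_cong[OF refl])
    fix y :: real
    have "measure_pmf.prob M {\<omega>. y < Y \<omega>} = measure_pmf.expectation M (indicator {\<omega>. y < Y \<omega>})"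
      by simp
    also have "\<dots> = (\<Sum>\<omega>\<in>set_pmf M. indicator {\<omega>. y < Y \<omega>} \<omega> * pmf M \<omega>)"
      by (rule integral_measure_pmf_real[OF fin]) auto
    finally have P: "measure_pmf.prob M {\<omega>. y < Y \<omega>} =
      (\<Sum>\<omega>\<in>set_pmf M. indicator {\<omega>. y < Y \<omega>} \<omega> * pmf M \<omega>)" .
    show "indicator {0..} y * (real (Suc r) * y ^ r * measure_pmf.prob M {\<omega>. y < Y \<omega>}) =
        (\<Sum>\<omega>\<in>set_pmf M. ?g \<omega> y)"
      unfolding P sum_distrib_left by (intro sum.cong refl) (auto simp: indicator_def)
  qed
  also have "\<dots> = (\<Sum>\<omega>\<in>set_pmf M. pmf M \<omega> * Y \<omega> ^ Suc r)"
    by (intro has_bochner_integral_integral_eq has_bochner_integral_sum g)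
  also have "\<dots> = measure_pmf.expectation M (\<lambda>\<omega>. Y \<omega> ^ Suc r)"
    by (subst integral_measure_pmf_real[OF fin]) (auto simp: mult.commute)
  finally show ?thesis by simp
qed

text \<open>
  Dominated convergence for the tail integrals. The exponential bound makes the tails integrable against
  every power, the dominating function being a multiple of an Erlang density. The hypotheses hold only
  eventually, so the sequences are shifted.
\<close>
lemma power_moments_tendsto:
  fixes M :: "nat \<Rightarrow> 'a pmf" and Y :: "nat \<Rightarrow> 'a \<Rightarrow> real"
  assumes fin: "\<forall>\<^sub>F m in sequentially. finite (set_pmf (M m))"
    and nonneg: "\<And>m \<omega>. 0 \<le> Y m \<omega>"
    and tail: "\<forall>\<^sub>F m in sequentially. \<forall>y\<ge>0. measure_pmf.prob (M m) {\<omega>. y < Y m \<omega>} \<le> exp (1 - y / 2)"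
    and lim: "\<And>y. 0 \<le> y \<Longrightarrow> (\<lambda>m. measure_pmf.prob (M m) {\<omega>. y < Y m \<omega>}) \<longlonglongrightarrow> g y"
    and [measurable]: "g \<in> borel_measurable borel"
  shows "(\<lambda>m. measure_pmf.expectation (M m) (\<lambda>\<omega>. Y m \<omega> ^ Suc r)) \<longlonglongrightarrow>
    (\<integral>y. indicator {0..} y * (real (Suc r) * y ^ r * g y) \<partial>lborel)"
proof -
  let ?P = "\<lambda>m y. measure_pmf.prob (M m) {\<omega>. y < Y m \<omega>}"
  obtain N where N: "\<And>m. m \<ge> N \<Longrightarrow> finite (set_pmf (M m))"
    "\<And>m y. m \<ge> N \<Longrightarrow> 0 \<le> y \<Longrightarrow> ?P m y \<le> exp (1 - y / 2)"
    using eventually_conj[OF fin tail] unfolding eventually_sequentially by blast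
  have meas [measurable]: "?P m \<in> borel_measurable borel" for m
  proof -
    have "mono (\<lambda>y. - ?P m y)"
      by (intro monoI le_imp_neg_le measure_pmf.finite_measure_mono) auto
    from borel_measurable_mono[OF this] have "(\<lambda>y. - (- ?P m y)) \<in> borel_measurable borel"
      by (rule borel_measurable_uminus)
    then show ?thesis by simp
  qed
  define w where "w = (\<lambda>y. (real (Suc r) * exp 1 * fact r / (1 / 2) ^ Suc r) * erlang_density r (1 / 2) y)"
  have "integrable lborel (erlang_density r (1 / 2))"
  proof (rule integrableI_nonneg)
    show "(\<integral>\<^sup>+ x. ennreal (erlang_density r (1 / 2) x) \<partial>lborel) < \<infinity>"
      using nn_integral_erlang_ith_moment[of "1 / 2" r 0] by simp
  qed (auto simp: erlang_density_def)
  then have w: "integrable lborel w" unfolding w_def by (rule integrable_mult_right)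
  have "(\<lambda>m. \<integral>y. indicator {0..} y * (real (Suc r) * y ^ r * ?P (m + N) y) \<partial>lborel) \<longlonglongrightarrow>
      (\<integral>y. indicator {0..} y * (real (Suc r) * y ^ r * g y) \<partial>lborel)"
  proof (rule integral_dominated_convergence[OF _ _ w])
    show "AE y in lborel. (\<lambda>m. indicator {0..} y * (real (Suc r) * y ^ r * ?P (m + N) y)) \<longlonglongrightarrow>
        indicator {0..} y * (real (Suc r) * y ^ r * g y)"
    proof (rule AE_I2)
      fix y :: real
      show "(\<lambda>m. indicator {0..} y * (real (Suc r) * y ^ r * ?P (m + N) y)) \<longlonglongrightarrow>
          indicator {0..} y * (real (Suc r) * y ^ r * g y)"
        by (cases "0 \<le> y") (auto intro!: tendsto_intros LIMSEQ_ignore_initial_segment[OF lim])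
    qed
    show "AE y in lborel. norm (indicator {0..} y * (real (Suc r) * y ^ r * ?P (m + N) y)) \<le> w y" for m
    proof (rule AE_I2)
      fix y :: real
      show "norm (indicator {0..} y * (real (Suc r) * y ^ r * ?P (m + N) y)) \<le> w y"
      proof (cases "0 \<le> y")
        case True
        have "norm (indicator {0..} y * (real (Suc r) * y ^ r * ?P (m + N) y)) =
            real (Suc r) * y ^ r * ?P (m + N) y"
          using True by (simp add: abs_mult)
        also have "\<dots> \<le> real (Suc r) * y ^ r * exp (1 - y / 2)"
          using True by (intro mult_left_mono N) auto
        also have "\<dots> = w y"
        proof -
          have cancel: "(c * e * f / h) * (h * t * d / f) = c * t * (e * d)"
            if "f \<noteq> 0" "h \<noteq> 0" for c d e f h t :: real
            using that by simp
          have "w y = real (Suc r) * y ^ r * (exp 1 * exp (- (1 / 2) * y))"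
            using True unfolding w_def erlang_density_def by (subst if_not_P) (simp, rule cancel, simp_all)
          then show ?thesis by (simp flip: exp_add)
        qed
        finally show ?thesis .
      qed (simp add: w_def erlang_density_def)
    qed
  qed measurable
  then have "(\<lambda>m. measure_pmf.expectation (M (m + N)) (\<lambda>\<omega>. Y (m + N) \<omega> ^ Suc r)) \<longlonglongrightarrow>
      (\<integral>y. indicator {0..} y * (real (Suc r) * y ^ r * g y) \<partial>lborel)"
    by (simp only: pmf_power_moment_layer_cake[OF N(1) nonneg] le_add2)
  then show ?thesis by (rule LIMSEQ_offset)
qed

section \<open>Limits for the repetition time\<close>

text \<open>
  The square root of the scaled variable. Working with it instead of the square makes the odd moments of
  \<open>tau\<close>, in particular its expectation, accessible with integer exponents.
\<close>
definition rescaled_tau :: "nat \<Rightarrow> outcome \<Rightarrow> real" where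
  "rescaled_tau m \<omega> = real (tau \<omega>) / (sqrt 2 * real m)"

lemma scaled_tau_eq: "scaled_tau m \<omega> = rescaled_tau m \<omega> ^ 2"
  by (simp add: scaled_tau_def rescaled_tau_def power_divide power_mult_distrib)

lemma prob_rescaled_tau_gt:
  assumes "m > 0" and "0 \<le> y"
  shows "measure_pmf.prob (model m) {\<omega>. y < rescaled_tau m \<omega>} =
    trail_freq m (nat \<lfloor>sqrt 2 * real m * y\<rfloor>)"
proof -
  have "y < rescaled_tau m \<omega> \<longleftrightarrow> nat \<lfloor>sqrt 2 * real m * y\<rfloor> < tau \<omega>" for \<omega>
  proof -
    have "y < rescaled_tau m \<omega> \<longleftrightarrow> sqrt 2 * real m * y < real (tau \<omega>)"
      using assms by (simp add: rescaled_tau_def less_divide_eq mult_ac)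
    also have "\<dots> \<longleftrightarrow> nat \<lfloor>sqrt 2 * real m * y\<rfloor> < tau \<omega>"
      using assms by (simp add: nat_less_iff floor_less_iff)
    finally show ?thesis .
  qed
  then show ?thesis using prob_tau_gt[OF assms(1)] by simp
qed

lemma prob_rescaled_tau_gt_tendsto:
  assumes "0 \<le> y"
  shows "(\<lambda>m. measure_pmf.prob (model m) {\<omega>. y < rescaled_tau m \<omega>}) \<longlonglongrightarrow> exp (- (y ^ 2))"
  using trail_freq_tendsto[OF assms]
  by (rule Lim_transform_eventually)
     (use eventually_gt_at_top[of 0] in eventually_elim, simp add: prob_rescaled_tau_gt assms)

text \<open>
  The hypothesis names the value of a half-line Gaussian moment, so that the even and the odd case can be
  treated alike.
\<close>
lemma rescaled_tau_moment_tendsto: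
  assumes "has_bochner_integral lborel (\<lambda>y::real. indicator {0..} y *\<^sub>R (exp (- y\<^sup>2) * y ^ r)) I"
  shows "(\<lambda>m. measure_pmf.expectation (model m) (\<lambda>\<omega>. rescaled_tau m \<omega> ^ Suc r)) \<longlonglongrightarrow> real (Suc r) * I"
proof -
  have "(\<lambda>m. measure_pmf.expectation (model m) (\<lambda>\<omega>. rescaled_tau m \<omega> ^ Suc r)) \<longlonglongrightarrow>
      (\<integral>y. indicator {0..} y * (real (Suc r) * y ^ r * exp (- (y ^ 2))) \<partial>lborel)"
  proof (rule power_moments_tendsto)
    show "\<forall>\<^sub>F m in sequentially. finite (set_pmf (model m))"
      using eventually_gt_at_top[of 0] by eventually_elim (simp add: set_pmf_model finite_outcomes)
    show "\<forall>\<^sub>F m in sequentially. \<forall>y\<ge>0.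
        measure_pmf.prob (model m) {\<omega>. y < rescaled_tau m \<omega>} \<le> exp (1 - y / 2)"
      using trail_freq_exp_tail eventually_gt_at_top[of 0]
      by eventually_elim (simp add: prob_rescaled_tau_gt)
      show "0 \<le> rescaled_tau m \<omega>" for m \<omega> by (simp add: rescaled_tau_def)
  qed (use prob_rescaled_tau_gt_tendsto in auto)
  also have "(\<lambda>y. indicator {0..} y * (real (Suc r) * y ^ r * exp (- (y ^ 2)))) =
      (\<lambda>y. real (Suc r) * (indicator {0..} y *\<^sub>R (exp (- y\<^sup>2) * y ^ r)))"
    by (auto simp: indicator_def)
  also have "(\<integral>y. real (Suc r) * (indicator {0..} y *\<^sub>R (exp (- y\<^sup>2) * y ^ r)) \<partial>lborel) = real (Suc r) * I"
    by (intro has_bochner_integral_integral_eq has_bochner_integral_mult_right assms)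
  finally show ?thesis .
qed

lemma prob_space_Exp1: "prob_space Exp1"
  unfolding Exp1_def by (rule prob_space_exponential_density) simp

lemma distributed_Exp1: "distributed Exp1 lborel (\<lambda>x. x) (exponential_density 1)"
  unfolding distributed_def Exp1_def
  by (auto simp: distr_id2 exponential_density_nonneg)

lemma Exp1_moment: "integral\<^sup>L Exp1 (\<lambda>x. x ^ p) = fact p"
  using prob_space.erlang_ith_moment[OF prob_space_Exp1 _ distributed_Exp1, of p] by simp

lemma cdf_Exp1: "cdf Exp1 x = (if x < 0 then 0 else 1 - exp (- x))"
proof -
  have "cdf Exp1 x = erlang_CDF 0 1 x"
    using prob_space.erlang_distributed_le[OF prob_space_Exp1 distributed_Exp1, of x]
      emeasure_erlang_density[of 1 0 x]
    by (simp add: cdf_def Exp1_def measure_def erlang_CDF_nonneg)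
  then show ?thesis by (simp add: erlang_CDF_0)
qed

lemma weak_conv_scaled_tau:
  "weak_conv_m (\<lambda>m. distr (measure_pmf (model m)) borel (scaled_tau m)) Exp1"
  unfolding weak_conv_m_def weak_conv_def
proof (intro allI impI)
  fix x :: real
  have cdf_eq: "cdf (distr (measure_pmf (model m)) borel (scaled_tau m)) x =
      measure_pmf.prob (model m) {\<omega>. scaled_tau m \<omega> \<le> x}" for m
    by (simp add: cdf_def measure_distr vimage_def)
  show "(\<lambda>m. cdf (distr (measure_pmf (model m)) borel (scaled_tau m)) x) \<longlonglongrightarrow> cdf Exp1 x"
  proof (cases "x < 0")
    case True
    have "{\<omega>. scaled_tau m \<omega> \<le> x} = {}" for m
    proof -
      have "0 \<le> scaled_tau m \<omega>" for \<omega> by (simp add: scaled_tau_def)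
      then show ?thesis using True by (auto simp: not_le intro: less_le_trans)
    qed
    then show ?thesis using True by (simp only: cdf_eq cdf_Exp1) simp
  next
    case False
    have "scaled_tau m \<omega> \<le> x \<longleftrightarrow> \<not> sqrt x < rescaled_tau m \<omega>" for m \<omega>
    proof -
      have "0 \<le> rescaled_tau m \<omega>" by (simp add: rescaled_tau_def)
      then show ?thesis
        using False unfolding scaled_tau_eq not_less
        by (metis real_le_rsqrt real_sqrt_abs abs_of_nonneg real_sqrt_le_iff)
    qed
    then have "{\<omega>. scaled_tau m \<omega> \<le> x} = space (measure_pmf (model m)) - {\<omega>. sqrt x < rescaled_tau m \<omega>}" for m
      by auto
    then have "measure_pmf.prob (model m) {\<omega>. scaled_tau m \<omega> \<le> x} =
        1 - measure_pmf.prob (model m) {\<omega>. sqrt x < rescaled_tau m \<omega>}" for m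
      by (simp only:) (rule measure_pmf.prob_compl, simp)
    moreover have "(\<lambda>m. 1 - measure_pmf.prob (model m) {\<omega>. sqrt x < rescaled_tau m \<omega>}) \<longlonglongrightarrow>
        1 - exp (- (sqrt x ^ 2))"
      using False by (intro tendsto_intros prob_rescaled_tau_gt_tendsto) simp
    ultimately show ?thesis using False by (simp add: cdf_eq cdf_Exp1)
  qed
qed

text \<open>
  With \<open>p = k + 1\<close> the odd Gaussian moment \<open>k! / 2\<close> is multiplied by \<open>2 p\<close>, which gives \<open>p!\<close>.
\<close>
lemma scaled_tau_moment_tendsto:
  "(\<lambda>m. measure_pmf.expectation (model m) (\<lambda>\<omega>. scaled_tau m \<omega> ^ p)) \<longlonglongrightarrow> fact p"
proof (cases p)
  case 0
  then show ?thesis by simp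
next
  case (Suc k)
  have "(\<lambda>m. measure_pmf.expectation (model m) (\<lambda>\<omega>. rescaled_tau m \<omega> ^ Suc (2 * k + 1)))
      \<longlonglongrightarrow> real (Suc (2 * k + 1)) * (fact k / 2)"
    by (rule rescaled_tau_moment_tendsto[OF gaussian_moment_odd_pos])
  moreover have "rescaled_tau m \<omega> ^ Suc (2 * k + 1) = scaled_tau m \<omega> ^ p" for m \<omega>
    unfolding scaled_tau_eq power_mult[symmetric] Suc by simp
  moreover have "real (Suc (2 * k + 1)) * (fact k / 2) = fact p"
    by (simp add: Suc algebra_simps)
  ultimately show ?thesis by simp
qed

lemma expectation_tau_over_tendsto:
  "(\<lambda>m. measure_pmf.expectation (model m) (\<lambda>\<omega>. real (tau \<omega>)) / real m) \<longlonglongrightarrow> sqrt (pi / 2)"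
proof -
  have "(\<lambda>m. measure_pmf.expectation (model m) (\<lambda>\<omega>. rescaled_tau m \<omega> ^ Suc 0))
      \<longlonglongrightarrow> real (Suc 0) * (sqrt pi / 2)"
    using gaussian_moment_0 by (intro rescaled_tau_moment_tendsto) simp
  then have "(\<lambda>m. sqrt 2 * (measure_pmf.expectation (model m) (\<lambda>\<omega>. real (tau \<omega>)) / (sqrt 2 * real m)))
      \<longlonglongrightarrow> sqrt 2 * (sqrt pi / 2)"
    by (intro tendsto_mult_left) (simp add: rescaled_tau_def)
  also have "sqrt 2 * (sqrt pi / 2) = sqrt (pi / 2)"
    by (simp add: real_sqrt_divide real_div_sqrt field_simps)
  finally show ?thesis by simp
qed

text \<open>
  The second moment is asymptotic to \<open>2 m\<^sup>2\<close> by the first moment of the scaled variable, and the square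
  of the expectation to \<open>m\<^sup>2 \<pi> / 2\<close>.
\<close>
lemma variance_tau_over_tendsto:
  "(\<lambda>m. measure_pmf.variance (model m) (\<lambda>\<omega>. real (tau \<omega>)) / (real m)\<^sup>2) \<longlonglongrightarrow> 2 - pi / 2"
proof -
  let ?E = "\<lambda>m. measure_pmf.expectation (model m)"
  have second: "(\<lambda>m. ?E m (\<lambda>\<omega>. scaled_tau m \<omega> ^ 1)) \<longlonglongrightarrow> fact 1"
    by (rule scaled_tau_moment_tendsto)
  have "(\<lambda>m. 2 * ?E m (\<lambda>\<omega>. scaled_tau m \<omega> ^ 1) - (?E m (\<lambda>\<omega>. real (tau \<omega>)) / real m) ^ 2)
      \<longlonglongrightarrow> 2 * fact 1 - sqrt (pi / 2) ^ 2"
    by (intro tendsto_intros second expectation_tau_over_tendsto)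
  then have lim: "(\<lambda>m. 2 * ?E m (\<lambda>\<omega>. scaled_tau m \<omega> ^ 1) - (?E m (\<lambda>\<omega>. real (tau \<omega>)) / real m) ^ 2)
      \<longlonglongrightarrow> 2 - pi / 2" by simp
  show ?thesis
  proof (rule Lim_transform_eventually[OF lim])
    show "\<forall>\<^sub>F m in sequentially. 2 * ?E m (\<lambda>\<omega>. scaled_tau m \<omega> ^ 1) - (?E m (\<lambda>\<omega>. real (tau \<omega>)) / real m) ^ 2 =
        measure_pmf.variance (model m) (\<lambda>\<omega>. real (tau \<omega>)) / (real m)\<^sup>2"
      using eventually_gt_at_top[of 0]
    proof eventually_elim
      case (elim m)
      have "finite (set_pmf (model m))" using elim by (simp add: set_pmf_model finite_outcomes)
      then have "measure_pmf.variance (model m) (\<lambda>\<omega>. real (tau \<omega>)) =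
          ?E m (\<lambda>\<omega>. (real (tau \<omega>))\<^sup>2) - (?E m (\<lambda>\<omega>. real (tau \<omega>)))\<^sup>2"
        by (intro measure_pmf.variance_eq integrable_measure_pmf_finite)
      moreover have "?E m (\<lambda>\<omega>. scaled_tau m \<omega> ^ 1) = ?E m (\<lambda>\<omega>. (real (tau \<omega>))\<^sup>2) / (2 * (real m)\<^sup>2)"
        by (simp add: scaled_tau_def)
      ultimately show ?case using elim by (simp add: field_simps)
    qed
  qed
qed

theorem theorem1p1:
  shows "weak_conv_m (\<lambda>m. distr (measure_pmf (model m)) borel (scaled_tau m)) Exp1
    \<and> (\<forall>p::nat. (\<lambda>m. measure_pmf.expectation (model m) (\<lambda>\<omega>. scaled_tau m \<omega> ^ p))
           \<longlonglongrightarrow> integral\<^sup>L Exp1 (\<lambda>x. x ^ p))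
    \<and> (\<lambda>m. measure_pmf.expectation (model m) (\<lambda>\<omega>. real (tau \<omega>)))
           \<sim>[sequentially] (\<lambda>m. real m * sqrt (pi / 2))
    \<and> (\<lambda>m. measure_pmf.variance (model m) (\<lambda>\<omega>. real (tau \<omega>)))
           \<sim>[sequentially] (\<lambda>m. (2 - pi / 2) * (real m)\<^sup>2)"
proof (intro conjI allI)
  have ratio: "f \<sim>[sequentially] (\<lambda>m. c * h m)"
    if "(\<lambda>m. f m / h m) \<longlonglongrightarrow> c" "c \<noteq> 0" "\<forall>\<^sub>F m in sequentially. h m \<noteq> 0" for f h :: "nat \<Rightarrow> real" and c
  proof (rule asymp_equivI')
    have "(\<lambda>m. f m / h m / c) \<longlonglongrightarrow> c / c"
      using that(2) by (intro tendsto_divide that(1)) auto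
    then show "(\<lambda>m. f m / (c * h m)) \<longlonglongrightarrow> 1" using that(2) by (simp add: mult.commute)
  qed
  show "weak_conv_m (\<lambda>m. distr (measure_pmf (model m)) borel (scaled_tau m)) Exp1"
    by (rule weak_conv_scaled_tau)
  show "(\<lambda>m. measure_pmf.expectation (model m) (\<lambda>\<omega>. scaled_tau m \<omega> ^ p))
      \<longlonglongrightarrow> integral\<^sup>L Exp1 (\<lambda>x. x ^ p)" for p
    unfolding Exp1_moment by (rule scaled_tau_moment_tendsto)
  show "(\<lambda>m. measure_pmf.expectation (model m) (\<lambda>\<omega>. real (tau \<omega>)))
      \<sim>[sequentially] (\<lambda>m. real m * sqrt (pi / 2))"
    unfolding mult.commute[of "real _"]
    by (intro ratio expectation_tau_over_tendsto eventually_mono[OF eventually_gt_at_top[of 0]]) auto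
  show "(\<lambda>m. measure_pmf.variance (model m) (\<lambda>\<omega>. real (tau \<omega>)))
      \<sim>[sequentially] (\<lambda>m. (2 - pi / 2) * (real m)\<^sup>2)"
    using pi_less_4
    by (intro ratio variance_tau_over_tendsto eventually_mono[OF eventually_gt_at_top[of 0]]) auto
qed

end
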